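(* Let $(S;\cdot,\backslash,/)$ be a right product quasigroup. Then $S$ is a right product right loop if and only if it satisfies any one (and hence all) of the following identities: (i) $(x\cdot(y\backslash y))\cdot z=x\cdot z$; (ii) $(x\backslash x)\cdot z=(y\backslash y)\cdot z$; (iii) $(x\circ y)\backslash(x\circ y)=y\backslash y$, where $\circ$ is any one of the operations $\cdot,\backslash,/$. That is, each of these identities (with (iii) counted as one identity for each choice of $\circ$) is individually equivalent to $S$ being a right product right loop.
   Context: A quasigroup is an algebra $(Q;\cdot,\backslash,/)$ satisfying $x\backslash(x\cdot y)=y$, $x\cdot(x\backslash y)=y$, $(x\cdot y)/y=x$, $(x/y)\cdot y=x$. A right loop is a quasigroup satisfying $x\backslash x=y\backslash y$. A right zero semigroup is regarded as an algebra $(R;\cdot,\backslash,/)$ with $x\cdot y=x\backslash y=x/y=y$. A right product quasigroup (respectively right product right loop) is an algebra isomorphic to a direct product $Q\times R$ with $Q$ a quasigroup (respectively a right loop) and $R$ a right zero semigroup. *)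

theory Defs
  imports "HOL-Algebra.Congruence"
begin

record 'a div_alg = "'a partial_object" +
  mul  :: "'a \<Rightarrow> 'a \<Rightarrow> 'a" (infixl \<open>\<cdot>\<index>\<close> 70)
  ldiv :: "'a \<Rightarrow> 'a \<Rightarrow> 'a" (infixl \<open>\<setminus>\<index>\<close> 70)
  rdiv :: "'a \<Rightarrow> 'a \<Rightarrow> 'a" (infixl \<open>\<div>\<index>\<close> 70)

text \<open>Carriers may be empty, in line with the equational definitions below.\<close>

locale div_algebra =
  fixes A (structure)
  assumes mul_closed:  "\<lbrakk>x \<in> carrier A; y \<in> carrier A\<rbrakk> \<Longrightarrow> x \<cdot> y \<in> carrier A"
    and ldiv_closed: "\<lbrakk>x \<in> carrier A; y \<in> carrier A\<rbrakk> \<Longrightarrow> x \<setminus> y \<in> carrier A"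
    and rdiv_closed: "\<lbrakk>x \<in> carrier A; y \<in> carrier A\<rbrakk> \<Longrightarrow> x \<div> y \<in> carrier A"

locale quasigroup = div_algebra Q for Q (structure) +
  assumes ldiv_mul: "\<lbrakk>x \<in> carrier Q; y \<in> carrier Q\<rbrakk> \<Longrightarrow> x \<setminus> (x \<cdot> y) = y"
    and mul_ldiv: "\<lbrakk>x \<in> carrier Q; y \<in> carrier Q\<rbrakk> \<Longrightarrow> x \<cdot> (x \<setminus> y) = y"
    and mul_rdiv: "\<lbrakk>x \<in> carrier Q; y \<in> carrier Q\<rbrakk> \<Longrightarrow> (x \<cdot> y) \<div> y = x"
    and rdiv_mul: "\<lbrakk>x \<in> carrier Q; y \<in> carrier Q\<rbrakk> \<Longrightarrow> (x \<div> y) \<cdot> y = x"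

locale right_loop = quasigroup Q for Q (structure) +
  assumes ldiv_self: "\<lbrakk>x \<in> carrier Q; y \<in> carrier Q\<rbrakk> \<Longrightarrow> x \<setminus> x = y \<setminus> y"

text \<open>Associativity follows from \<open>x \<cdot> y = y\<close>.\<close>

locale right_zero_semigroup = div_algebra R for R (structure) +
  assumes mul_right_zero:  "\<lbrakk>x \<in> carrier R; y \<in> carrier R\<rbrakk> \<Longrightarrow> x \<cdot> y = y"
    and ldiv_right_zero: "\<lbrakk>x \<in> carrier R; y \<in> carrier R\<rbrakk> \<Longrightarrow> x \<setminus> y = y"
    and rdiv_right_zero: "\<lbrakk>x \<in> carrier R; y \<in> carrier R\<rbrakk> \<Longrightarrow> x \<div> y = y"

definition direct_product :: "'a div_alg \<Rightarrow> 'b div_alg \<Rightarrow> ('a \<times> 'b) div_alg" where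
  "direct_product A B =
     \<lparr> carrier = carrier A \<times> carrier B,
       mul  = (\<lambda>(a, b) (a', b'). (a \<cdot>\<^bsub>A\<^esub> a', b \<cdot>\<^bsub>B\<^esub> b')),
       ldiv = (\<lambda>(a, b) (a', b'). (a \<setminus>\<^bsub>A\<^esub> a', b \<setminus>\<^bsub>B\<^esub> b')),
       rdiv = (\<lambda>(a, b) (a', b'). (a \<div>\<^bsub>A\<^esub> a', b \<div>\<^bsub>B\<^esub> b')) \<rparr>"

definition div_alg_iso :: "('a \<Rightarrow> 'b) \<Rightarrow> 'a div_alg \<Rightarrow> 'b div_alg \<Rightarrow> bool" where
  "div_alg_iso h A B \<longleftrightarrow>
     bij_betw h (carrier A) (carrier B) \<and>
     (\<forall>x \<in> carrier A. \<forall>y \<in> carrier A.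
        h (x \<cdot>\<^bsub>A\<^esub> y) = h x \<cdot>\<^bsub>B\<^esub> h y \<and>
        h (x \<setminus>\<^bsub>A\<^esub> y) = h x \<setminus>\<^bsub>B\<^esub> h y \<and>
        h (x \<div>\<^bsub>A\<^esub> y) = h x \<div>\<^bsub>B\<^esub> h y)"

text \<open>
  In the next two definitions the factors have carriers in the element type of \<open>S\<close>, since
  a definition cannot quantify over types. Nothing is lost: the lemmas
  \<open>right_product_quasigroupI\<close> and \<open>right_product_right_loopI\<close> below allow factors
  over arbitrary types.
\<close>

definition right_product_quasigroup :: "'a div_alg \<Rightarrow> bool" where
  "right_product_quasigroup S \<longleftrightarrow> div_algebra S \<and>
     (\<exists>(Q :: 'a div_alg) (R :: 'a div_alg) h.
        quasigroup Q \<and> right_zero_semigroup R \<and> div_alg_iso h S (direct_product Q R))"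

definition right_product_right_loop :: "'a div_alg \<Rightarrow> bool" where
  "right_product_right_loop S \<longleftrightarrow> div_algebra S \<and>
     (\<exists>(Q :: 'a div_alg) (R :: 'a div_alg) h.
        right_loop Q \<and> right_zero_semigroup R \<and> div_alg_iso h S (direct_product Q R))"

definition transport :: "('a \<Rightarrow> 'b) \<Rightarrow> 'a div_alg \<Rightarrow> 'b div_alg" where
  "transport f A = (let g = inv_into (carrier A) f in
     \<lparr> carrier = f ` carrier A,
       mul  = (\<lambda>x y. f (g x \<cdot>\<^bsub>A\<^esub> g y)),
       ldiv = (\<lambda>x y. f (g x \<setminus>\<^bsub>A\<^esub> g y)),
       rdiv = (\<lambda>x y. f (g x \<div>\<^bsub>A\<^esub> g y)) \<rparr>)"

lemma transport_simps:
  assumes "inj_on f (carrier A)"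
  shows "carrier (transport f A) = f ` carrier A"
    and "\<lbrakk>x \<in> carrier A; y \<in> carrier A\<rbrakk> \<Longrightarrow> f x \<cdot>\<^bsub>transport f A\<^esub> f y = f (x \<cdot>\<^bsub>A\<^esub> y)"
    and "\<lbrakk>x \<in> carrier A; y \<in> carrier A\<rbrakk> \<Longrightarrow> f x \<setminus>\<^bsub>transport f A\<^esub> f y = f (x \<setminus>\<^bsub>A\<^esub> y)"
    and "\<lbrakk>x \<in> carrier A; y \<in> carrier A\<rbrakk> \<Longrightarrow> f x \<div>\<^bsub>transport f A\<^esub> f y = f (x \<div>\<^bsub>A\<^esub> y)"
  using assms by (simp_all add: transport_def Let_def)

lemma transport_div_algebra:
  assumes "div_algebra A" "inj_on f (carrier A)"
  shows "div_algebra (transport f A)"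
  using assms(1)
  by (auto simp: div_algebra_def transport_simps[OF assms(2)])

lemma transport_quasigroup:
  assumes "quasigroup A" "inj_on f (carrier A)"
  shows "quasigroup (transport f A)"
  using assms(1) transport_div_algebra[OF _ assms(2)]
  by (auto simp: quasigroup_def quasigroup_axioms_def div_algebra_def
      transport_simps[OF assms(2)])

lemma transport_right_loop:
  assumes "right_loop A" "inj_on f (carrier A)"
  shows "right_loop (transport f A)"
proof (intro right_loop.intro right_loop_axioms.intro)
  show "quasigroup (transport f A)"
    using assms transport_quasigroup right_loop.axioms(1) by blast
next
  fix x y assume "x \<in> carrier (transport f A)" "y \<in> carrier (transport f A)"
  then obtain a b where ab: "a \<in> carrier A" "b \<in> carrier A" "x = f a" "y = f b"
    unfolding transport_simps(1)[OF assms(2)] by blast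
  then have "a \<setminus>\<^bsub>A\<^esub> a = b \<setminus>\<^bsub>A\<^esub> b"
    using right_loop.ldiv_self[OF assms(1)] by blast
  with ab show "x \<setminus>\<^bsub>transport f A\<^esub> x = y \<setminus>\<^bsub>transport f A\<^esub> y"
    by (simp only: transport_simps(3)[OF assms(2)])
qed

lemma transport_right_zero:
  assumes "right_zero_semigroup A" "inj_on f (carrier A)"
  shows "right_zero_semigroup (transport f A)"
  using assms(1) transport_div_algebra[OF _ assms(2)]
  by (auto simp: right_zero_semigroup_def right_zero_semigroup_axioms_def
      transport_simps[OF assms(2)])

lemma iso_transport:
  fixes S :: "'a div_alg" and Q :: "'b div_alg" and R :: "'c div_alg"
  assumes S: "div_algebra S" and h: "div_alg_iso h S (direct_product Q R)"
    and ne: "carrier S \<noteq> {}"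
  shows "\<exists>(f :: 'b \<Rightarrow> 'a) (g :: 'c \<Rightarrow> 'a) k. inj_on f (carrier Q) \<and> inj_on g (carrier R) \<and>
    div_alg_iso k S (direct_product (transport f Q) (transport g R))"
proof -
  have bij: "bij_betw h (carrier S) (carrier Q \<times> carrier R)"
    using h by (simp add: div_alg_iso_def direct_product_def)
  then obtain q0 r0 where qr: "q0 \<in> carrier Q" "r0 \<in> carrier R"
    using ne by (metis bij_betw_imp_surj_on ex_in_conv image_is_empty mem_Sigma_iff surj_pair)
  define i where "i = inv_into (carrier S) h"
  have i: "inj_on i (carrier Q \<times> carrier R)"
    using bij unfolding i_def by (metis bij_betw_def bij_betw_inv_into)
  define f where "f q = i (q, r0)" for q
  define g where "g r = i (q0, r)" for r
  have f: "inj_on f (carrier Q)" and g: "inj_on g (carrier R)"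
    using i qr by (auto simp: inj_on_def f_def g_def)
  define k where "k s = map_prod f g (h s)" for s
  have "bij_betw (map_prod f g) (carrier Q \<times> carrier R) (f ` carrier Q \<times> g ` carrier R)"
    using f g by (auto simp: bij_betw_def intro: map_prod_inj_on)
  then have "bij_betw k (carrier S) (f ` carrier Q \<times> g ` carrier R)"
    using bij_betw_trans[OF bij] by (simp add: k_def[abs_def] comp_def)
  moreover have "k (x \<cdot>\<^bsub>S\<^esub> y) = k x \<cdot>\<^bsub>direct_product (transport f Q) (transport g R)\<^esub> k y \<and>
      k (x \<setminus>\<^bsub>S\<^esub> y) = k x \<setminus>\<^bsub>direct_product (transport f Q) (transport g R)\<^esub> k y \<and>
      k (x \<div>\<^bsub>S\<^esub> y) = k x \<div>\<^bsub>direct_product (transport f Q) (transport g R)\<^esub> k y"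
    if "x \<in> carrier S" "y \<in> carrier S" for x y
  proof -
    obtain a b c d where ab: "h x = (a, b)" "h y = (c, d)" by (meson surj_pair)
    then have "a \<in> carrier Q" "b \<in> carrier R" "c \<in> carrier Q" "d \<in> carrier R"
      using that bij_betw_apply[OF bij] by (metis mem_Sigma_iff)+
    then show ?thesis
      using h that ab
      by (simp add: k_def div_alg_iso_def direct_product_def
          transport_simps[OF f] transport_simps[OF g])
  qed
  ultimately have "div_alg_iso k S (direct_product (transport f Q) (transport g R))"
    by (simp add: div_alg_iso_def direct_product_def transport_simps(1)[OF f]
        transport_simps(1)[OF g])
  then show ?thesis using f g by blast
qed

lemma empty_product:
  assumes "carrier S = {}"
  shows "right_loop S" "quasigroup S" "right_zero_semigroup S"
    "div_alg_iso (\<lambda>x. (x, x)) S (direct_product S S)"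
  using assms
  by (auto simp: right_loop_def right_loop_axioms_def quasigroup_def quasigroup_axioms_def
      right_zero_semigroup_def right_zero_semigroup_axioms_def div_algebra_def
      div_alg_iso_def direct_product_def bij_betw_def)

lemma right_product_quasigroupI:
  fixes S :: "'a div_alg" and Q :: "'b div_alg" and R :: "'c div_alg"
  assumes "div_algebra S" "quasigroup Q" "right_zero_semigroup R"
    "div_alg_iso h S (direct_product Q R)"
  shows "right_product_quasigroup S"
proof (cases "carrier S = {}")
  case True
  then show ?thesis
    using assms(1) empty_product unfolding right_product_quasigroup_def by blast
next
  case False
  then show ?thesis
    using iso_transport[OF assms(1,4)] transport_quasigroup[OF assms(2)]
      transport_right_zero[OF assms(3)] assms(1)
    unfolding right_product_quasigroup_def by blast
qed

lemma right_product_right_loopI: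
  fixes S :: "'a div_alg" and Q :: "'b div_alg" and R :: "'c div_alg"
  assumes "div_algebra S" "right_loop Q" "right_zero_semigroup R"
    "div_alg_iso h S (direct_product Q R)"
  shows "right_product_right_loop S"
proof (cases "carrier S = {}")
  case True
  then show ?thesis
    using assms(1) empty_product unfolding right_product_right_loop_def by blast
next
  case False
  then show ?thesis
    using iso_transport[OF assms(1,4)] transport_right_loop[OF assms(2)]
      transport_right_zero[OF assms(3)] assms(1)
    unfolding right_product_right_loop_def by blast
qed

end

theory Submission imports Defs begin

text \<open>
  A term built from the three operations evaluates in a right zero semigroup to its rightmost
  variable. Each of the identities at issue has the same rightmost variable on both sides, so it
  holds in every right zero semigroup, and hence holds in a product \<open>Q \<times> R\<close> with \<open>R\<close>
  nonempty exactly when it holds in the quasigroup \<open>Q\<close>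
  (\<open>right_loop_factor_iff\<close>). In a quasigroup, cancellation and divisibility
  turn each identity into \<open>x \<setminus> x = y \<setminus> y\<close>, which says that \<open>Q\<close> is a right
  loop (\<open>right_loop_iff\<close>).

  That \<open>S\<close> is a right product right loop says only that \<^emph>\<open>some\<close> decomposition of \<open>S\<close>
  has a right loop as its quasigroup factor. But the identities are conditions on \<open>S\<close> alone, so
  passing through one of them shows that the factor \<open>Q\<close> of \<^emph>\<open>any\<close> decomposition is then
  a right loop (\<open>right_product_right_loop_iff\<close>).
\<close>

context quasigroup
begin

lemma mul_left_cancel:
  assumes "a \<in> carrier Q" "x \<in> carrier Q" "y \<in> carrier Q"
  shows "a \<cdot> x = a \<cdot> y \<longleftrightarrow> x = y"
  using assms by (metis ldiv_mul)

lemma mul_right_cancel: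
  assumes "x \<in> carrier Q" "y \<in> carrier Q" "a \<in> carrier Q"
  shows "x \<cdot> a = y \<cdot> a \<longleftrightarrow> x = y"
  using assms by (metis mul_rdiv)

lemma right_loop_iff_ldiv_self:
  "right_loop Q \<longleftrightarrow> (\<forall>x \<in> carrier Q. \<forall>y \<in> carrier Q. x \<setminus> x = y \<setminus> y)"
  by (auto simp: right_loop_def right_loop_axioms_def quasigroup_axioms)

text \<open>
  The first two identities reduce to \<open>x \<setminus> x = y \<setminus> y\<close> by cancelling \<open>z\<close>; in the
  first, \<open>x \<cdot> (y \<setminus> y) = x\<close> is then compared with \<open>x \<cdot> (x \<setminus> x) = x\<close>. For the
  last three, given \<open>y\<close>, every element \<open>a\<close> has the form \<open>x \<cdot> y\<close>, the form
  \<open>x \<setminus> y\<close> and the form \<open>x \<div> y\<close> for suitable \<open>x\<close>.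
\<close>

lemma right_loop_iff:
  shows "right_loop Q \<longleftrightarrow>
      (\<forall>x \<in> carrier Q. \<forall>y \<in> carrier Q. \<forall>z \<in> carrier Q. (x \<cdot> (y \<setminus> y)) \<cdot> z = x \<cdot> z)"
    and "right_loop Q \<longleftrightarrow>
      (\<forall>x \<in> carrier Q. \<forall>y \<in> carrier Q. \<forall>z \<in> carrier Q. (x \<setminus> x) \<cdot> z = (y \<setminus> y) \<cdot> z)"
    and "right_loop Q \<longleftrightarrow>
      (\<forall>x \<in> carrier Q. \<forall>y \<in> carrier Q. (x \<cdot> y) \<setminus> (x \<cdot> y) = y \<setminus> y)"
    and "right_loop Q \<longleftrightarrow>
      (\<forall>x \<in> carrier Q. \<forall>y \<in> carrier Q. (x \<setminus> y) \<setminus> (x \<setminus> y) = y \<setminus> y)"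
    and "right_loop Q \<longleftrightarrow>
      (\<forall>x \<in> carrier Q. \<forall>y \<in> carrier Q. (x \<div> y) \<setminus> (x \<div> y) = y \<setminus> y)"
proof -
  have "x \<setminus> x = y \<setminus> y \<longleftrightarrow> (x \<cdot> (y \<setminus> y)) \<cdot> z = x \<cdot> z"
    if "x \<in> carrier Q" "y \<in> carrier Q" "z \<in> carrier Q" for x y z
    using that by (metis mul_right_cancel mul_left_cancel mul_ldiv mul_closed ldiv_closed)
  then show "right_loop Q \<longleftrightarrow>
      (\<forall>x \<in> carrier Q. \<forall>y \<in> carrier Q. \<forall>z \<in> carrier Q. (x \<cdot> (y \<setminus> y)) \<cdot> z = x \<cdot> z)"
    unfolding right_loop_iff_ldiv_self by blast
  show "right_loop Q \<longleftrightarrow>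
      (\<forall>x \<in> carrier Q. \<forall>y \<in> carrier Q. \<forall>z \<in> carrier Q. (x \<setminus> x) \<cdot> z = (y \<setminus> y) \<cdot> z)"
    unfolding right_loop_iff_ldiv_self by (metis mul_right_cancel ldiv_closed)
  show "right_loop Q \<longleftrightarrow>
      (\<forall>x \<in> carrier Q. \<forall>y \<in> carrier Q. (x \<cdot> y) \<setminus> (x \<cdot> y) = y \<setminus> y)"
    unfolding right_loop_iff_ldiv_self by (metis rdiv_mul rdiv_closed mul_closed)
  \<comment> \<open>\<open>a = (y \<div> a) \<setminus> y\<close>\<close>
  have "\<exists>x \<in> carrier Q. x \<setminus> y = a" if "y \<in> carrier Q" "a \<in> carrier Q" for y a
    using that by (metis rdiv_mul rdiv_closed ldiv_mul)
  then show "right_loop Q \<longleftrightarrow>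
      (\<forall>x \<in> carrier Q. \<forall>y \<in> carrier Q. (x \<setminus> y) \<setminus> (x \<setminus> y) = y \<setminus> y)"
    unfolding right_loop_iff_ldiv_self by (metis ldiv_closed)
  show "right_loop Q \<longleftrightarrow>
      (\<forall>x \<in> carrier Q. \<forall>y \<in> carrier Q. (x \<div> y) \<setminus> (x \<div> y) = y \<setminus> y)"
    unfolding right_loop_iff_ldiv_self by (metis mul_rdiv mul_closed rdiv_closed)
qed

end

locale right_product_decomposition =
  div_algebra S + Q: quasigroup Q + R: right_zero_semigroup R
  for S :: "'a div_alg" (structure) and Q :: "'b div_alg" and R :: "'c div_alg" +
  fixes h
  assumes iso: "div_alg_iso h S (direct_product Q R)"
begin

definition proj_Q :: "'a \<Rightarrow> 'b" where "proj_Q x = fst (h x)"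

definition proj_R :: "'a \<Rightarrow> 'c" where "proj_R x = snd (h x)"

lemma bij: "bij_betw h (carrier S) (carrier Q \<times> carrier R)"
  using iso by (simp add: div_alg_iso_def direct_product_def)

lemma proj_closed:
  assumes "x \<in> carrier S"
  shows "proj_Q x \<in> carrier Q" "proj_R x \<in> carrier R"
  using bij_betw_apply[OF bij assms] by (auto simp: proj_Q_def proj_R_def)

lemma proj_Q_hom:
  assumes "x \<in> carrier S" "y \<in> carrier S"
  shows "proj_Q (x \<cdot> y) = proj_Q x \<cdot>\<^bsub>Q\<^esub> proj_Q y"
    "proj_Q (x \<setminus> y) = proj_Q x \<setminus>\<^bsub>Q\<^esub> proj_Q y"
    "proj_Q (x \<div> y) = proj_Q x \<div>\<^bsub>Q\<^esub> proj_Q y"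
  using iso assms
  by (simp_all add: div_alg_iso_def direct_product_def proj_Q_def split: prod.splits)

lemma proj_R_rightmost:
  assumes "x \<in> carrier S" "y \<in> carrier S"
  shows "proj_R (x \<cdot> y) = proj_R y" "proj_R (x \<setminus> y) = proj_R y" "proj_R (x \<div> y) = proj_R y"
proof -
  have "proj_R (x \<cdot> y) = proj_R x \<cdot>\<^bsub>R\<^esub> proj_R y"
    "proj_R (x \<setminus> y) = proj_R x \<setminus>\<^bsub>R\<^esub> proj_R y"
    "proj_R (x \<div> y) = proj_R x \<div>\<^bsub>R\<^esub> proj_R y"
    using iso assms
    by (simp_all add: div_alg_iso_def direct_product_def proj_R_def split: prod.splits)
  then show "proj_R (x \<cdot> y) = proj_R y" "proj_R (x \<setminus> y) = proj_R y" "proj_R (x \<div> y) = proj_R y"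
    using assms proj_closed(2)
    by (simp_all add: R.mul_right_zero R.ldiv_right_zero R.rdiv_right_zero)
qed

lemma eq_iff_proj:
  assumes "x \<in> carrier S" "y \<in> carrier S"
  shows "x = y \<longleftrightarrow> proj_Q x = proj_Q y \<and> proj_R x = proj_R y"
  using inj_on_eq_iff[OF bij_betw_imp_inj_on[OF bij] assms]
  by (auto simp: proj_Q_def proj_R_def prod_eq_iff)

lemma proj_Q_image:
  assumes "carrier S \<noteq> {}"
  shows "carrier Q = proj_Q ` carrier S"
proof -
  have "carrier R \<noteq> {}"
    using assms proj_closed(2) by blast
  then have "carrier Q = fst ` (h ` carrier S)"
    unfolding bij_betw_imp_surj_on[OF bij] by simp
  then show ?thesis
    by (simp add: image_image proj_Q_def)
qed

text \<open>
  The two sides of each identity always agree under \<open>proj_R\<close>, since they end in the same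
  variable. So the identity holds in \<open>S\<close> iff it holds after applying \<open>proj_Q\<close>, which is
  onto \<open>Q\<close> when \<open>S\<close> is nonempty. If instead \<open>R\<close>
  is empty, then so is \<open>S\<close>, which satisfies every identity while \<open>Q\<close> is an
  arbitrary quasigroup.
\<close>

lemma right_loop_factor_iff:
  assumes "carrier S \<noteq> {}"
  shows "right_loop Q \<longleftrightarrow>
      (\<forall>x \<in> carrier S. \<forall>y \<in> carrier S. \<forall>z \<in> carrier S. (x \<cdot> (y \<setminus> y)) \<cdot> z = x \<cdot> z)"
    and "right_loop Q \<longleftrightarrow>
      (\<forall>x \<in> carrier S. \<forall>y \<in> carrier S. \<forall>z \<in> carrier S. (x \<setminus> x) \<cdot> z = (y \<setminus> y) \<cdot> z)"
    and "right_loop Q \<longleftrightarrow>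
      (\<forall>x \<in> carrier S. \<forall>y \<in> carrier S. (x \<cdot> y) \<setminus> (x \<cdot> y) = y \<setminus> y)"
    and "right_loop Q \<longleftrightarrow>
      (\<forall>x \<in> carrier S. \<forall>y \<in> carrier S. (x \<setminus> y) \<setminus> (x \<setminus> y) = y \<setminus> y)"
    and "right_loop Q \<longleftrightarrow>
      (\<forall>x \<in> carrier S. \<forall>y \<in> carrier S. (x \<div> y) \<setminus> (x \<div> y) = y \<setminus> y)"
proof -
  note transfer = eq_iff_proj proj_Q_hom proj_R_rightmost proj_Q_image[OF assms]
    mul_closed ldiv_closed rdiv_closed
  show "right_loop Q \<longleftrightarrow>
      (\<forall>x \<in> carrier S. \<forall>y \<in> carrier S. \<forall>z \<in> carrier S. (x \<cdot> (y \<setminus> y)) \<cdot> z = x \<cdot> z)"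
    unfolding Q.right_loop_iff(1) by (simp add: transfer)
  show "right_loop Q \<longleftrightarrow>
      (\<forall>x \<in> carrier S. \<forall>y \<in> carrier S. \<forall>z \<in> carrier S. (x \<setminus> x) \<cdot> z = (y \<setminus> y) \<cdot> z)"
    unfolding Q.right_loop_iff(2) by (simp add: transfer)
  show "right_loop Q \<longleftrightarrow>
      (\<forall>x \<in> carrier S. \<forall>y \<in> carrier S. (x \<cdot> y) \<setminus> (x \<cdot> y) = y \<setminus> y)"
    unfolding Q.right_loop_iff(3) by (simp add: transfer)
  show "right_loop Q \<longleftrightarrow>
      (\<forall>x \<in> carrier S. \<forall>y \<in> carrier S. (x \<setminus> y) \<setminus> (x \<setminus> y) = y \<setminus> y)"
    unfolding Q.right_loop_iff(4) by (simp add: transfer)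
  show "right_loop Q \<longleftrightarrow>
      (\<forall>x \<in> carrier S. \<forall>y \<in> carrier S. (x \<div> y) \<setminus> (x \<div> y) = y \<setminus> y)"
    unfolding Q.right_loop_iff(5) by (simp add: transfer)
qed

lemma right_product_right_loop_iff:
  assumes "carrier S \<noteq> {}"
  shows "right_product_right_loop S \<longleftrightarrow> right_loop Q"
proof
  assume "right_loop Q"
  then show "right_product_right_loop S"
    using right_product_right_loopI[OF div_algebra_axioms _ R.right_zero_semigroup_axioms iso]
    by blast
next
  assume "right_product_right_loop S"
  then obtain Q' R' :: "'a div_alg" and h' where
    "right_loop Q'" "right_zero_semigroup R'" "div_alg_iso h' S (direct_product Q' R')"
    unfolding right_product_right_loop_def by blast
  then interpret other: right_product_decomposition S Q' R' h'
    by (intro right_product_decomposition.intro right_product_decomposition_axioms.intro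
        div_algebra_axioms right_loop.axioms(1))
  show "right_loop Q"
    using \<open>right_loop Q'\<close> other.right_loop_factor_iff(2)[OF assms] right_loop_factor_iff(2)[OF assms]
    by blast
qed

end

theorem corollary2p19:
  fixes S :: "'a div_alg" (structure)
  assumes "right_product_quasigroup S"
  shows
    "(right_product_right_loop S \<longleftrightarrow>
        (\<forall>x \<in> carrier S. \<forall>y \<in> carrier S. \<forall>z \<in> carrier S. (x \<cdot> (y \<setminus> y)) \<cdot> z = x \<cdot> z)) \<and>
     (right_product_right_loop S \<longleftrightarrow>
        (\<forall>x \<in> carrier S. \<forall>y \<in> carrier S. \<forall>z \<in> carrier S. (x \<setminus> x) \<cdot> z = (y \<setminus> y) \<cdot> z)) \<and>
     (right_product_right_loop S \<longleftrightarrow>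
        (\<forall>x \<in> carrier S. \<forall>y \<in> carrier S. (x \<cdot> y) \<setminus> (x \<cdot> y) = y \<setminus> y)) \<and>
     (right_product_right_loop S \<longleftrightarrow>
        (\<forall>x \<in> carrier S. \<forall>y \<in> carrier S. (x \<setminus> y) \<setminus> (x \<setminus> y) = y \<setminus> y)) \<and>
     (right_product_right_loop S \<longleftrightarrow>
        (\<forall>x \<in> carrier S. \<forall>y \<in> carrier S. (x \<div> y) \<setminus> (x \<div> y) = y \<setminus> y))"
proof (cases "carrier S = {}")
  case True
  moreover have "div_algebra S"
    using assms by (simp add: right_product_quasigroup_def)
  ultimately have "right_product_right_loop S"
    using right_product_right_loopI empty_product by blast
  with True show ?thesis by simp
next
  case False
  obtain Q R :: "'a div_alg" and h where
    "quasigroup Q" "right_zero_semigroup R" "div_alg_iso h S (direct_product Q R)" "div_algebra S"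
    using assms unfolding right_product_quasigroup_def by blast
  then interpret right_product_decomposition S Q R h
    by (intro right_product_decomposition.intro right_product_decomposition_axioms.intro)
  show ?thesis
    unfolding right_product_right_loop_iff[OF False]
    using right_loop_factor_iff[OF False] by blast
qed

end
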